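(* For each integer $n \ge 5$, let $D(n)$ be the maximum of $|E(G)|/\binom{n}{2}$ over all distance critical graphs $G$ on $n$ vertices. Then $1 - O(1/\sqrt{n}) \le D(n) \le 1 - \Omega(1/n)$ as $n \to \infty$.
   Context: All graphs are finite, simple and undirected. For vertices $x,y$ of a graph $G$, $d_G(x,y)$ is the length of a shortest path from $x$ to $y$ in $G$ ($\infty$ if none exists). A graph $G$ is distance critical if for every vertex $v \in V(G)$ there exist vertices $x,y \in V(G)\setminus\{v\}$ with $d_G(x,y) \neq d_{G-v}(x,y)$. The edge density of a graph on $n$ vertices is $|E(G)|/\binom{n}{2}$. *)

theory Defs
  imports Complex_Main "HOL-Library.Extended_Nat"
begin

text \<open>A graph is given by its vertex set and its set of edges, an edge being a two-element set of
  vertices.\<close>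

definition simple_graph :: "'a set \<Rightarrow> 'a set set \<Rightarrow> bool" where
  "simple_graph V E \<longleftrightarrow> finite V \<and> (\<forall>e\<in>E. e \<subseteq> V \<and> card e = 2)"

definition is_path :: "'a set \<Rightarrow> 'a set set \<Rightarrow> 'a \<Rightarrow> 'a list \<Rightarrow> 'a \<Rightarrow> bool" where
  "is_path V E x p y \<longleftrightarrow>
     p \<noteq> [] \<and> hd p = x \<and> last p = y \<and> set p \<subseteq> V \<and> distinct p \<and>
     successively (\<lambda>a b. {a, b} \<in> E) p"

text \<open>The length of a path is its number of edges; the infimum of the empty set in \<^typ>\<open>enat\<close>
  is \<open>\<infinity>\<close>.\<close>

definition graph_dist :: "'a set \<Rightarrow> 'a set set \<Rightarrow> 'a \<Rightarrow> 'a \<Rightarrow> enat" where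
  "graph_dist V E x y = (INF p \<in> {p. is_path V E x p y}. enat (length p - 1))"

definition distance_critical :: "'a set \<Rightarrow> 'a set set \<Rightarrow> bool" where
  "distance_critical V E \<longleftrightarrow>
     (\<forall>v\<in>V. \<exists>x\<in>V - {v}. \<exists>y\<in>V - {v}.
        graph_dist V E x y \<noteq> graph_dist (V - {v}) {e \<in> E. v \<notin> e} x y)"

definition edge_density :: "'a set \<Rightarrow> 'a set set \<Rightarrow> real" where
  "edge_density V E = real (card E) / real (card V choose 2)"

text \<open>Every finite graph is isomorphic to one whose vertices are natural numbers, so nothing is lost
  by drawing the vertices from \<^typ>\<open>nat\<close>.\<close>

definition critical_densities :: "nat \<Rightarrow> real set" where
  "critical_densities n =
     {edge_density V E | (V :: nat set) E.
        simple_graph V E \<and> card V = n \<and> distance_critical V E}"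

lemma finite_critical_densities: "finite (critical_densities n)"
proof (rule finite_subset)
  show "critical_densities n \<subseteq> (\<lambda>k. real k / real (n choose 2)) ` {..n choose 2}"
  proof
    fix d assume "d \<in> critical_densities n"
    then obtain V :: "nat set" and E where
      d: "d = edge_density V E" and G: "simple_graph V E" and n: "card V = n"
      unfolding critical_densities_def by blast
    have V: "finite V" and sub: "E \<subseteq> {e. e \<subseteq> V \<and> card e = 2}"
      using G by (auto simp: simple_graph_def)
    have "card E \<le> card {e. e \<subseteq> V \<and> card e = 2}"
      using V by (intro card_mono sub) auto
    then have "card E \<le> n choose 2"
      using n_subsets[OF V, of 2] n by simp
    then show "d \<in> (\<lambda>k. real k / real (n choose 2)) ` {..n choose 2}"
      using d n by (auto simp: edge_density_def)
  qed
qed simp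

definition D :: "nat \<Rightarrow> real" where
  "D n = Max (critical_densities n)"

end

theory Submission imports Defs begin

text \<open>A vertex \<open>v\<close> changes some distance iff it is the only common neighbour of two non-adjacent
  vertices: these are the neighbours of \<open>v\<close> on a shortest path that cannot be rerouted around \<open>v\<close>.
  A non-adjacent pair serves at most one \<open>v\<close>, so a critical graph has at least \<open>n\<close> non-edges.
  Conversely, take a cycle of length \<open>m = O(\<surd>n)\<close> and a clique on the other vertices, and join each clique
  vertex to two cycle vertices at cycle distance at least 3, distinct clique vertices receiving distinct
  pairs. Only \<open>O(n\<^sup>3\<^sup>/\<^sup>2)\<close> edges are missing, a clique vertex is the only common neighbour of its pair,
  and a cycle vertex that of its two neighbours on the cycle.\<close>

section \<open>Criticality in terms of unique common neighbours\<close>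

lemma simple_graph_edgeD:
  assumes "simple_graph V E" "{a, b} \<in> E"
  shows "a \<in> V" "b \<in> V" "a \<noteq> b"
  using assms by (auto simp: simple_graph_def dest: bspec[where x = "{a, b}"])

definition only_link :: "'a set set \<Rightarrow> 'a \<Rightarrow> 'a \<Rightarrow> 'a \<Rightarrow> bool" where
  "only_link E v x y \<longleftrightarrow> x \<noteq> y \<and> {x, y} \<notin> E \<and> {x, v} \<in> E \<and> {v, y} \<in> E \<and>
     (\<forall>w. {x, w} \<in> E \<longrightarrow> {w, y} \<in> E \<longrightarrow> w = v)"

lemma graph_dist_le: "is_path V E x p y \<Longrightarrow> graph_dist V E x y \<le> enat (length p - 1)"
  unfolding graph_dist_def by (rule INF_lower) simp

lemma is_path_delete:
  assumes "is_path V E x p y" "v \<notin> set p"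
  shows "is_path (V - {v}) {e \<in> E. v \<notin> e} x p y"
  using assms unfolding is_path_def
  by (auto intro: successively_mono[where P = "\<lambda>a b. {a, b} \<in> E"])

lemma graph_dist_delete_ge:
  "graph_dist V E x y \<le> graph_dist (V - {v}) {e \<in> E. v \<notin> e} x y"
  unfolding graph_dist_def
  by (rule INF_superset_mono) (auto simp: is_path_def intro: successively_mono)

lemma graph_dist_attained:
  assumes "graph_dist V E x y \<noteq> \<infinity>"
  obtains p where "is_path V E x p y" "graph_dist V E x y = enat (length p - 1)"
proof -
  let ?S = "(\<lambda>p. enat (length p - 1)) ` {p. is_path V E x p y}"
  have "?S \<noteq> {}"
  proof
    assume "?S = {}"
    then have "graph_dist V E x y = \<infinity>"
      by (simp only: graph_dist_def Inf_empty top_enat_def)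
    then show False using assms by simp
  qed
  then have "Inf ?S \<in> ?S"
    by (metis Inf_enat_def LeastI_ex ex_in_conv)
  then show ?thesis
    using that by (auto simp: graph_dist_def)
qed

text \<open>The path \<open>[x, v, y]\<close> gives distance at most 2. Without \<open>v\<close>
  every path has at least four vertices: two would need an edge \<open>{x, y}\<close>, three another
  common neighbour. The new distance may be \<infinity>.\<close>

lemma only_link_changes_dist:
  assumes G: "simple_graph V E" and L: "only_link E v x y"
  shows "graph_dist V E x y \<noteq> graph_dist (V - {v}) {e \<in> E. v \<notin> e} x y"
proof -
  have xy: "x \<noteq> y" "{x, y} \<notin> E" and xv: "{x, v} \<in> E" and vy: "{v, y} \<in> E"
    and u: "\<And>w. {x, w} \<in> E \<Longrightarrow> {w, y} \<in> E \<Longrightarrow> w = v"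
    using L by (auto simp: only_link_def)
  have "is_path V E x [x, v, y] y"
    using simple_graph_edgeD[OF G xv] simple_graph_edgeD[OF G vy] xv vy xy
    by (auto simp: is_path_def)
  from graph_dist_le[OF this] have le: "graph_dist V E x y \<le> 2"
    by (simp add: numeral_eq_enat numeral_2_eq_2)
  have "3 \<le> graph_dist (V - {v}) {e \<in> E. v \<notin> e} x y"
    unfolding graph_dist_def
  proof (rule INF_greatest)
    fix p assume "p \<in> {p. is_path (V - {v}) {e \<in> E. v \<notin> e} x p y}"
    then have p: "is_path (V - {v}) {e \<in> E. v \<notin> e} x p y" by simp
    have "length p \<ge> 4"
    proof (rule ccontr)
      assume "\<not> length p \<ge> 4"
      then have "length p = 0 \<or> length p = 1 \<or> length p = 2 \<or> length p = 3" by arith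
      then consider "p = []" | a where "p = [a]" | a b where "p = [a, b]" | a b c where "p = [a, b, c]"
        by (auto simp: length_Suc_conv numeral_eq_Suc)
      then show False
        using p xy u by cases (auto simp: is_path_def)
    qed
    then show "3 \<le> enat (length p - 1)"
      by (simp add: numeral_eq_enat)
  qed
  moreover have "(2::enat) < 3" by simp
  ultimately show ?thesis
    using le by (metis leD order_trans)
qed

text \<open>Every shortest path from \<open>x\<close> to \<open>y\<close> runs through
  \<open>v\<close>; take for \<open>a\<close> and \<open>b\<close> the neighbours of
  \<open>v\<close> on one of them. An edge \<open>{a, b}\<close> or a second common neighbour would
  yield a path avoiding \<open>v\<close> that is no longer.\<close>

lemma changed_dist_imp_only_link:
  assumes xv: "x \<noteq> v" and yv: "y \<noteq> v" and G: "simple_graph V E"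
    and ne: "graph_dist V E x y \<noteq> graph_dist (V - {v}) {e \<in> E. v \<notin> e} x y"
  shows "\<exists>a b. only_link E v a b"
proof -
  have lt: "graph_dist V E x y < graph_dist (V - {v}) {e \<in> E. v \<notin> e} x y"
    using graph_dist_delete_ge[of V E x y v] ne by (simp add: order.strict_iff_order)
  then have "graph_dist V E x y \<noteq> \<infinity>"
    by (cases "graph_dist V E x y") auto
  then obtain p where p: "is_path V E x p y" and dp: "graph_dist V E x y = enat (length p - 1)"
    by (rule graph_dist_attained)
  \<comment> \<open>By \<open>lt\<close>, every path that avoids \<open>v\<close> is longer than
    \<open>p\<close>.\<close>
  have no_bypass: False if "is_path V E x q y" "v \<notin> set q" "length q \<le> length p" for q
  proof -
    have "graph_dist (V - {v}) {e \<in> E. v \<notin> e} x y \<le> enat (length q - 1)"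
      using that by (intro graph_dist_le is_path_delete)
    also have "\<dots> \<le> graph_dist V E x y"
      using that(3) dp by simp
    finally show False using lt by simp
  qed
  have "v \<in> set p" using no_bypass p by blast
  then obtain as bs where sp: "p = as @ v # bs" by (meson split_list)
  have asn: "as \<noteq> []" and bsn: "bs \<noteq> []"
    using p xv yv sp by (auto simp: is_path_def)
  define a b where "a = last as" and "b = hd bs"
  have succ: "successively (\<lambda>a b. {a, b} \<in> E) as" "successively (\<lambda>a b. {a, b} \<in> E) bs"
    and av: "{a, v} \<in> E" and vb: "{v, b} \<in> E"
    using p asn bsn unfolding is_path_def sp a_def b_def
    by (auto simp: successively_append_iff successively_Cons)
  have ends: "hd as = x" "last bs = y" and sub: "set as \<subseteq> V" "set bs \<subseteq> V"
    and dist: "distinct as" "distinct bs" "set as \<inter> set bs = {}" "v \<notin> set as" "v \<notin> set bs"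
    using p asn bsn unfolding is_path_def sp by auto
  have ab: "a \<noteq> b"
    using asn bsn dist(3) unfolding a_def b_def by (metis disjoint_iff hd_in_set last_in_set)
  have nab: "{a, b} \<notin> E"
  proof
    assume "{a, b} \<in> E"
    then have "is_path V E x (as @ bs) y"
      using asn bsn succ ends sub dist
      by (auto simp: is_path_def successively_append_iff a_def b_def)
    then show False
      using no_bypass[of "as @ bs"] dist sp by auto
  qed
  have "w = v" if aw: "{a, w} \<in> E" and wb: "{w, b} \<in> E" for w
  proof (rule ccontr)
    assume wv: "w \<noteq> v"
    have wV: "w \<in> V" using simple_graph_edgeD[OF G wb] by simp
    \<comment> \<open>Paths have distinct vertices, so \<open>w\<close> can replace \<open>v\<close>
      only when it is off the path. If \<open>w\<close> already lies on it, going from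
      \<open>w\<close> straight to \<open>b\<close>, or from \<open>a\<close> straight to
      \<open>w\<close>, skips \<open>v\<close>.\<close>
    consider "w \<in> set as" | "w \<in> set bs" | "w \<notin> set as" "w \<notin> set bs" by blast
    then show False
    proof cases
      case 1
      then obtain cs ds where cs: "as = cs @ w # ds" by (meson split_list)
      have "hd (cs @ w # bs) = x" using ends(1) cs by (cases cs) auto
      then have "is_path V E x (cs @ w # bs) y"
        using bsn succ ends sub dist wb unfolding cs
        by (auto simp: is_path_def successively_append_iff successively_Cons b_def)
      then show False
        using no_bypass[of "cs @ w # bs"] dist sp cs by auto
    next
      case 2
      then obtain cs ds where cs: "bs = cs @ w # ds" by (meson split_list)
      have "is_path V E x (as @ w # ds) y"
        using asn succ ends sub dist aw unfolding cs
        by (auto simp: is_path_def successively_append_iff successively_Cons a_def)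
      then show False
        using no_bypass[of "as @ w # ds"] dist sp cs by auto
    next
      case 3
      have "is_path V E x (as @ w # bs) y"
        using asn bsn succ ends sub dist aw wb wV 3
        by (auto simp: is_path_def successively_append_iff successively_Cons a_def b_def)
      then show False
        using no_bypass[of "as @ w # bs"] dist sp wv by auto
    qed
  qed
  then show ?thesis
    using ab nab av vb unfolding only_link_def by blast
qed

text \<open>This removes distances from the rest of the argument, which works with adjacency
  only.\<close>

lemma distance_critical_iff:
  assumes "simple_graph V E"
  shows "distance_critical V E \<longleftrightarrow> (\<forall>v\<in>V. \<exists>x y. only_link E v x y)"
proof
  assume "distance_critical V E"
  then show "\<forall>v\<in>V. \<exists>x y. only_link E v x y"
    unfolding distance_critical_def using changed_dist_imp_only_link[OF _ _ assms] by fast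
next
  assume R: "\<forall>v\<in>V. \<exists>x y. only_link E v x y"
  show "distance_critical V E"
    unfolding distance_critical_def
  proof
    fix v assume "v \<in> V"
    then obtain x y where L: "only_link E v x y" using R by blast
    then have "{x, v} \<in> E" "{v, y} \<in> E" by (auto simp: only_link_def)
    then have "x \<in> V - {v}" "y \<in> V - {v}"
      using simple_graph_edgeD[OF assms] by blast+
    then show "\<exists>x\<in>V - {v}. \<exists>y\<in>V - {v}.
        graph_dist V E x y \<noteq> graph_dist (V - {v}) {e \<in> E. v \<notin> e} x y"
      using only_link_changes_dist[OF assms L] by blast
  qed
qed

section \<open>Counting non-edges of a critical graph\<close>

lemma critical_card_edges:
  assumes G: "simple_graph V E" and crit: "distance_critical V E"
  shows "card E + card V \<le> card V choose 2"
proof -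
  let ?P = "{e. e \<subseteq> V \<and> card e = 2}"
  have fin: "finite V" and EP: "E \<subseteq> ?P"
    using G by (auto simp: simple_graph_def)
  have finP: "finite ?P" using fin by simp
  obtain X Y where L: "\<And>v. v \<in> V \<Longrightarrow> only_link E v (X v) (Y v)"
    using crit unfolding distance_critical_iff[OF G] by metis
  \<comment> \<open>If \<open>u\<close> and \<open>v\<close> had the same pair, \<open>u\<close>
    would be a common neighbour of the pair of \<open>v\<close>, hence equal to
    \<open>v\<close>.\<close>
  have "inj_on (\<lambda>v. {X v, Y v}) V"
  proof (rule inj_onI)
    fix u v assume uv: "u \<in> V" "v \<in> V" "{X u, Y u} = {X v, Y v}"
    have "{X u, u} \<in> E" "{u, Y u} \<in> E"
      using L[OF uv(1)] by (simp_all add: only_link_def)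
    then have "{X v, u} \<in> E" "{u, Y v} \<in> E"
      using uv(3) by (auto simp: doubleton_eq_iff insert_commute)
    then show "u = v"
      using L[OF uv(2)] unfolding only_link_def by blast
  qed
  moreover have "(\<lambda>v. {X v, Y v}) ` V \<subseteq> ?P - E"
  proof (rule image_subsetI)
    fix v assume "v \<in> V"
    from L[OF this] have l: "X v \<noteq> Y v" "{X v, Y v} \<notin> E" "{X v, v} \<in> E" "{v, Y v} \<in> E"
      by (auto simp: only_link_def)
    then show "{X v, Y v} \<in> ?P - E"
      using simple_graph_edgeD[OF G l(3)] simple_graph_edgeD[OF G l(4)] by auto
  qed
  ultimately have "card V \<le> card (?P - E)"
    using finP by (intro card_inj_on_le) auto
  also have "\<dots> = (card V choose 2) - card E"
    using EP finP n_subsets[OF fin, of 2] by (subst card_Diff_subset) (auto intro: finite_subset)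
  finally show ?thesis
    using card_mono[OF finP EP] n_subsets[OF fin, of 2] by simp
qed

section \<open>The cycle-and-clique construction\<close>

text \<open>The cycle is \<open>0, \<dots>, m - 1\<close> and the clique is \<open>m, \<dots>, n - 1\<close>.\<close>

definition link_adj :: "nat \<Rightarrow> nat \<Rightarrow> (nat \<Rightarrow> nat) \<Rightarrow> (nat \<Rightarrow> nat) \<Rightarrow> nat \<Rightarrow> nat \<Rightarrow> bool" where
  "link_adj m n f g a b \<longleftrightarrow> a < b \<and>
     (b < m \<and> (b = Suc a \<or> a = 0 \<and> Suc b = m) \<or>
      m \<le> b \<and> b < n \<and> (m \<le> a \<or> a = f b \<or> a = g b))"

definition link_edges :: "nat \<Rightarrow> nat \<Rightarrow> (nat \<Rightarrow> nat) \<Rightarrow> (nat \<Rightarrow> nat) \<Rightarrow> nat set set" where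
  "link_edges m n f g = {{a, b} | a b. link_adj m n f g a b}"

lemma link_edges_iff:
  "{a, b} \<in> link_edges m n f g \<longleftrightarrow> link_adj m n f g a b \<or> link_adj m n f g b a"
  by (auto simp: link_edges_def doubleton_eq_iff)

lemma simple_graph_link_edges:
  "m \<le> n \<Longrightarrow> simple_graph {..<n} (link_edges m n f g)"
  by (auto simp: simple_graph_def link_edges_def link_adj_def)

text \<open>\<open>far\<close> keeps \<open>f v\<close> and \<open>g v\<close> at least 3 apart both
  ways round the cycle. So they share no neighbour on the cycle, and no clique vertex is joined to
  both neighbours of a cycle vertex. Those two neighbours would be adjacent for \<open>m = 3\<close>
  and have a second common neighbour for \<open>m = 4\<close>, hence
  \<open>5 \<le> m\<close>.\<close>

lemma distance_critical_link_edges: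
  assumes m: "5 \<le> m" "m \<le> n"
    and far: "\<And>v. m \<le> v \<Longrightarrow> v < n \<Longrightarrow> f v + 3 \<le> g v \<and> g v + 3 \<le> f v + m \<and> g v < m"
    and inj: "\<And>u v. \<lbrakk>m \<le> u; u < n; m \<le> v; v < n; f u = f v; g u = g v\<rbrakk> \<Longrightarrow> u = v"
  shows "distance_critical {..<n} (link_edges m n f g)"
  unfolding distance_critical_iff[OF simple_graph_link_edges[OF m(2)]]
proof
  fix v assume "v \<in> {..<n}"
  then have vn: "v < n" by simp
  show "\<exists>x y. only_link (link_edges m n f g) v x y"
  proof (cases "v < m")
    case False
    then have v: "m \<le> v" by simp
    have "w = v" if "link_adj m n f g (f v) w \<or> link_adj m n f g w (f v)"
      "link_adj m n f g (g v) w \<or> link_adj m n f g w (g v)" for w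
    proof (cases "w < m")
      case True
      then show ?thesis using that far[OF v vn] m by (auto simp: link_adj_def)
    next
      case False
      then have "w < n" "f v = f w \<or> f v = g w" "g v = f w \<or> g v = g w"
        using that far[OF v vn] by (auto simp: link_adj_def)
      \<comment> \<open>Since \<open>f\<close> is below \<open>g\<close> at both vertices, the
        crossed and the degenerate matches are impossible.\<close>
      then have "f v = f w \<and> g v = g w"
        using False far[OF v vn] far[of w] by auto
      then show ?thesis using inj[of w v] False \<open>w < n\<close> v vn by simp
    qed
    moreover have "link_adj m n f g (f v) v" "link_adj m n f g (g v) v"
      using far[OF v vn] v vn by (simp_all add: link_adj_def)
    moreover have "\<not> link_adj m n f g (f v) (g v)" "\<not> link_adj m n f g (g v) (f v)" "f v \<noteq> g v"
      using far[OF v vn] by (auto simp: link_adj_def)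
    ultimately have "only_link (link_edges m n f g) v (f v) (g v)"
      unfolding only_link_def link_edges_iff by blast
    then show ?thesis by blast
  next
    case True
    define x y where "x = (if v = 0 then m - 1 else v - 1)" and "y = (if Suc v = m then 0 else Suc v)"
    have xy: "x < m" "y < m" "x \<noteq> y" using True m by (auto simp: x_def y_def)
    have adj: "link_adj m n f g x v \<or> link_adj m n f g v x"
      "link_adj m n f g v y \<or> link_adj m n f g y v"
      using True m by (auto simp: x_def y_def link_adj_def)
    have nadj: "\<not> link_adj m n f g x y" "\<not> link_adj m n f g y x"
      using True m by (auto simp: x_def y_def link_adj_def split: if_splits)
    have "w = v" if "link_adj m n f g x w \<or> link_adj m n f g w x"
      "link_adj m n f g w y \<or> link_adj m n f g y w" for w
    proof (cases "w < m")
      case w: True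
      then show ?thesis
        using that True m by (auto simp: x_def y_def link_adj_def split: if_splits)
    next
      case False
      \<comment> \<open>A clique vertex joined to both \<open>x\<close> and \<open>y\<close> would
        have them as its pair, but they are only two steps apart on the cycle.\<close>
      then have w: "m \<le> w" "w < n" "x = f w \<or> x = g w" "y = f w \<or> y = g w"
        using that xy by (auto simp: link_adj_def)
      then show ?thesis
        using far[OF w(1,2)] xy True m by (auto simp: x_def y_def split: if_splits)
    qed
    then have "only_link (link_edges m n f g) v x y"
      using xy adj nadj unfolding only_link_def link_edges_iff by blast
    then show ?thesis by blast
  qed
qed

text \<open>The clique alone gives this bound; the cycle and the attachments add only O(n)
  edges.\<close>

lemma card_link_edges_ge:
  assumes "m \<le> n"
  shows "(n - m) choose 2 \<le> card (link_edges m n f g)"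
proof -
  have "{e. e \<subseteq> {m..<n} \<and> card e = 2} \<subseteq> link_edges m n f g"
  proof
    fix e assume e: "e \<in> {e. e \<subseteq> {m..<n} \<and> card e = 2}"
    then obtain a b where ab: "e = {a, b}" "a \<noteq> b" by (auto simp: card_2_iff)
    have "link_adj m n f g a b \<or> link_adj m n f g b a"
      using e ab by (auto simp: link_adj_def)
    then show "e \<in> link_edges m n f g" by (simp add: ab link_edges_iff)
  qed
  moreover have "finite (link_edges m n f g)"
    using simple_graph_link_edges[OF assms, of f g] finite_subset[of "link_edges m n f g" "Pow {..<n}"]
    by (auto simp: simple_graph_def)
  ultimately have "card {e. e \<subseteq> {m..<n} \<and> card e = 2} \<le> card (link_edges m n f g)"
    by (rule card_mono[rotated])
  then show ?thesis
    by (simp add: n_subsets)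
qed

text \<open>\<open>D n\<close> is a \<open>Max\<close>, meaningful only for a nonempty set. With
  \<open>m = n\<close> the clique is empty and the graph is a cycle on \<open>n\<close> vertices, so
  the conditions on the two maps are vacuous and \<open>id\<close> is a placeholder.\<close>

lemma critical_densities_nonempty:
  assumes "5 \<le> n"
  shows "critical_densities n \<noteq> {}"
proof -
  let ?E = "link_edges n n id id"
  have "distance_critical {..<n} ?E"
    using assms by (intro distance_critical_link_edges) auto
  then have "edge_density {..<n} ?E \<in> critical_densities n"
    unfolding critical_densities_def using simple_graph_link_edges[of n n id id]
    by (intro CollectI exI[of _ "{..<n}"] exI[of _ ?E]) auto
  then show ?thesis by blast
qed

section \<open>Density estimates\<close>

lemma real_choose_two: "real (n choose 2) = real n * (real n - 1) / 2"
proof -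
  have "2 * (n choose 2) = n * (n - 1)"
    unfolding choose_two by (rule dvd_mult_div_cancel) (cases n; simp)
  then have "2 * real (n choose 2) = real n * real (n - 1)"
    by (metis of_nat_mult of_nat_numeral)
  then show ?thesis by (cases n) auto
qed

lemma D_le:
  assumes n: "5 \<le> n"
  shows "D n \<le> 1 - 1 / real n"
proof -
  have "D n \<in> critical_densities n"
    unfolding D_def using critical_densities_nonempty[OF n] by (intro Max_in finite_critical_densities)
  then obtain V :: "nat set" and E where d: "D n = edge_density V E"
    and G: "simple_graph V E" "card V = n" "distance_critical V E"
    unfolding critical_densities_def by auto
  have "card E + n \<le> n choose 2"
    using critical_card_edges[OF G(1,3)] G(2) by simp
  then have "real (card E) + real n \<le> real (n choose 2)"
    by linarith
  moreover have pos: "real (n choose 2) > 0"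
    using n by simp
  ultimately have "D n \<le> (real (n choose 2) - real n) / real (n choose 2)"
    unfolding d edge_density_def G(2) by (intro divide_right_mono) auto
  also have "\<dots> = 1 - 2 / (real n - 1)"
    using n pos by (simp add: real_choose_two field_simps)
  also have "\<dots> \<le> 1 - 1 / real n"
    using n by (simp add: field_simps)
  finally show ?thesis .
qed

text \<open>Division by \<open>s\<close> codes a clique vertex, which is below \<open>s * s\<close>,
  by its quotient and remainder, both below \<open>s\<close>. Quotients take the cycle positions 0,
  ..., s - 1 and remainders s + 2, ..., 2s + 1. On a cycle of length 2s + 5 these arcs are 3 apart
  on one side and 4 on the other.\<close>

lemma D_ge:
  assumes m: "m = 2 * s + 5" "m \<le> n" "n \<le> s * s"
  shows "1 - 4 * real m / real n \<le> D n"
proof -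
  define f where "f v = v div s" for v
  define g where "g v = s + 2 + v mod s" for v
  let ?E = "link_edges m n f g"
  have "s > 0" using m by (cases s) auto
  have "distance_critical {..<n} ?E"
  proof (rule distance_critical_link_edges)
    fix v assume "m \<le> v" "v < n"
    then have "v div s < s"
      using m by (intro less_mult_imp_div_less) simp
    moreover have "v mod s < s" using \<open>s > 0\<close> by simp
    ultimately show "f v + 3 \<le> g v \<and> g v + 3 \<le> f v + m \<and> g v < m"
      using m unfolding f_def g_def by linarith
  next
    fix u v assume "f u = f v" "g u = g v"
    then show "u = v"
      unfolding f_def g_def by (metis add_left_cancel div_mult_mod_eq)
  qed (use m in auto)
  then have "edge_density {..<n} ?E \<in> critical_densities n"
    unfolding critical_densities_def using simple_graph_link_edges[OF m(2)]
    by (intro CollectI exI[of _ "{..<n}"] exI[of _ ?E]) auto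
  then have D: "edge_density {..<n} ?E \<le> D n"
    unfolding D_def by (intro Max_ge finite_critical_densities)
  have n: "n \<ge> 5" using m by simp
  have pos: "real (n choose 2) > 0" using n by simp
  \<comment> \<open>From n \<le> 2(n - 1): doubling the constant pays for replacing n - 1 by
    n.\<close>
  have "1 - 4 * real m / real n \<le> 1 - 2 * real m / (real n - 1)"
  proof -
    have "2 * real m * real n \<le> 4 * real m * (real n - 1)"
      using n mult_left_mono[of "real n" "2 * (real n - 1)" "2 * real m"] by (simp add: algebra_simps)
    then show ?thesis using n by (simp add: field_simps)
  qed
  also have "\<dots> = (real (n choose 2) - real m * real n) / real (n choose 2)"
    using n pos by (simp add: real_choose_two field_simps)
  also have "\<dots> \<le> real ((n - m) choose 2) / real (n choose 2)"
  proof (rule divide_right_mono)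
    \<comment> \<open>A pair not inside the clique contains one of the \<open>m\<close> cycle
      vertices, so there are at most \<open>m * n\<close> such pairs.\<close>
    show "real (n choose 2) - real m * real n \<le> real ((n - m) choose 2)"
      using m(2) by (simp add: real_choose_two of_nat_diff field_simps)
  qed simp
  also have "\<dots> \<le> real (card ?E) / real (n choose 2)"
    using card_link_edges_ge[OF m(2), of f g] by (intro divide_right_mono) auto
  also have "\<dots> \<le> D n"
    using D by (simp add: edge_density_def)
  finally show ?thesis .
qed

lemma D_ge_sqrt:
  assumes n: "81 \<le> n"
  shows "1 - 36 / sqrt (real n) \<le> D n"
proof -
  define s where "s = nat \<lceil>sqrt (real n)\<rceil>"
  define m where "m = 2 * s + 5"
  have q: "sqrt (real n) \<ge> 9"
    using n by (intro real_le_rsqrt) simp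
  have s: "sqrt (real n) \<le> real s" "real s \<le> sqrt (real n) + 1"
    unfolding s_def using q by (simp_all add: real_nat_ceiling_ge)
  have "real n \<le> real s * real s"
    using mult_mono[OF s(1) s(1)] q by simp
  then have ns: "n \<le> s * s" by (metis of_nat_le_iff of_nat_mult)
  \<comment> \<open>Here m \<le> 2 sqrt n + 7 \<le> 9 sqrt n, so the final constant is 36 = 4 * 9.
    The threshold 81 makes 9 sqrt n \<le> n, which yields \<open>m \<le> n\<close>.\<close>
  have m9: "real m \<le> 9 * sqrt (real n)"
    unfolding m_def using s q by simp
  also have "\<dots> \<le> sqrt (real n) * sqrt (real n)"
    using q by (intro mult_right_mono) auto
  finally have mn: "m \<le> n" by simp
  have "4 * real m / real n \<le> 4 * (9 * sqrt (real n)) / real n"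
    using m9 by (intro divide_right_mono) auto
  also have "\<dots> = 36 * (sqrt (real n) / real n)"
    by simp
  also have "\<dots> = 36 / sqrt (real n)"
    using sqrt_divide_self_eq[of "real n"] by (simp add: divide_inverse)
  finally show ?thesis
    using D_ge[OF m_def mn ns] by linarith
qed

theorem theorem5p10:
  shows "(\<forall>n\<ge>5. critical_densities n \<noteq> {}) \<and>
         (\<exists>C>0. \<forall>\<^sub>F n in sequentially. 1 - C / sqrt (real n) \<le> D n) \<and>
         (\<exists>c>0. \<forall>\<^sub>F n in sequentially. D n \<le> 1 - c / real n)"
proof (intro conjI)
  show "\<forall>n\<ge>5. critical_densities n \<noteq> {}"
    using critical_densities_nonempty by blast
  show "\<exists>C>0. \<forall>\<^sub>F n in sequentially. 1 - C / sqrt (real n) \<le> D n"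
    by (intro exI[of _ 36] conjI eventually_sequentiallyI[of 81] D_ge_sqrt) auto
  show "\<exists>c>0. \<forall>\<^sub>F n in sequentially. D n \<le> 1 - c / real n"
    by (intro exI[of _ 1] conjI eventually_sequentiallyI[of 5] D_le) auto
qed

end
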